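(* Let $(X,d)$ be a metric space, let $f\in UE(X)$, let $\{f_n\}_{n\in\mathbb{N}^+}$ be a sequence in $UE(X)$ such that $f_n$ is orbitally convergent to $f$ and $f_n^{-1}$ is orbitally convergent to $f^{-1}$, and let $x\in X$. Then the following statements are true: (i) $x\in Sh(f)$ if and only if for every $\epsilon>0$, $\bigcup_{m\geq 1}\bigcap_{n\geq m}Sh(f_n,x,\epsilon)\neq\emptyset$. (ii) $x\in P_{\alpha}(f)$ if and only if for every $\epsilon>0$, $\bigcup_{m\geq 1}\bigcap_{n\geq m}P_{\alpha}(f_n,x,\epsilon)\neq\emptyset$. (iii) $x\in Wts(f)$ if and only if for every $\epsilon>0$, $\bigcup_{m\geq 1}\bigcap_{n\geq m}Wts(f_n,x,\epsilon)\neq\emptyset$. (iv) If $f$ is expansive and $X$ is Mandelkern locally compact, then $x\in Ts(f)$ if and only if for every $\epsilon>0$, $\bigcup_{m\geq 1}\bigcap_{n\geq m}Wts(f_n,x,\epsilon)\neq\emptyset$.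
   Context: $\mathbb{N}^+=\{1,2,\dots\}$; $f^k$ denotes the $k$-th iterate. $UE(X)$ is the set of uniform equivalences of $X$, i.e. bijections $f:X\to X$ such that both $f$ and $f^{-1}$ are uniformly continuous. $X$ is Mandelkern locally compact if every bounded subset of $X$ is contained in a compact set (equivalently, every closed ball of finite radius is compact). For continuous $f,g:X\to X$, $D(f,g)=\sup_{x\in X}\min\{d(f(x),g(x)),1\}$. A sequence of uniformly continuous maps $g_n:X\to X$ is orbitally convergent to a uniformly continuous $g:X\to X$ if for every $\epsilon>0$ there is $N\in\mathbb{N}^+$ such that $d(g_n^k(x),g^k(x))<\epsilon$ for all $n\geq N$, all $x\in X$ and all $k\in\mathbb{N}^+$. $f\in UE(X)$ is expansive if there is $\delta>0$ such that for every pair of distinct points $x,y\in X$, $d(f^n(x),f^n(y))>\delta$ for some $n\in\mathbb{Z}$. Let $f\in UE(X)$, $x\in X$, $\epsilon>0$. For $g\in UE(X)$ write $\mathcal{O}_g(x)=\{g^n(x):n\in\mathbb{Z}\}$ and $\overline{\mathcal{O}}_g(x)$ for its closure. - A $\delta$-pseudo orbit for $f$ through $x$ is a sequence $\{x_i\}_{i\in\mathbb{Z}}$ in $X$ with $x_0=x$ and $d(f(x_i),x_{i+1})<\delta$ for each $i\in\mathbb{Z}$; it is $\epsilon$-traced through $f$ by $y\in X$ if $d(f^i(y),x_i)<\epsilon$ for each $i\in\mathbb{Z}$. $Sh(f,x,\epsilon)$ is the set of $\delta>0$ such that every $\delta$-pseudo orbit for $f$ through $x$ is $\epsilon$-traced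 through $f$ by some point of $X$. $Sh(f)$ (shadowable points) is the set of $x$ such that for every $\epsilon>0$ there is such a $\delta>0$. - $P_{\alpha}(f,x,\epsilon)$ is the set of $\delta>0$ such that for every $g\in UE(X)$ with $D(f,g)<\delta$ there is $y\in X$ with $d(f^n(y),g^n(x))<\epsilon$ for each $n\in\mathbb{Z}$. $P_{\alpha}(f)$ ($\alpha$-persistent points) is the set of $x$ such that for every $\epsilon>0$ there is such a $\delta>0$. - $Wts(f,x,\epsilon)$ is the set of $\delta>0$ such that for every $g\in UE(X)$ with $D(f,g)<\delta$ there is a continuous map $h:\overline{\mathcal{O}}_g(x)\to X$ such that $d(f^n(h(y)),g^n(y))<\epsilon$ for each $n\in\mathbb{Z}$ and each $y\in\overline{\mathcal{O}}_g(x)$, and $d(h(y),y)<\epsilon$ for each $y\in\overline{\mathcal{O}}_g(x)$. $Wts(f)$ (weak topologically stable points) is the set of $x$ such that for every $\epsilon>0$ there is such a $\delta>0$. - $Ts(f)$ (topologically stable points) is the set of $x$ such that for every $\epsilon>0$ there is $\delta>0$ such that for every $g\in UE(X)$ with $D(f,g)<\delta$ there is a continuous map $h:\overline{\mathcal{O}}_g(x)\to X$ with $f\circ h=h\circ g$ on $\overline{\mathcal{O}}_g(x)$ and $d(h(y),y)<\epsilon$ for each $y\in\overline{\mathcal{O}}_g(x)$. *)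

theory Defs
  imports "HOL-Analysis.Analysis"
begin

text \<open>The metric space \<open>X\<close> is an arbitrary type of class \<^class>\<open>metric_space\<close>.\<close>

definition UE :: "('a::metric_space \<Rightarrow> 'a) set" where
  "UE = {f. bij f \<and> uniformly_continuous_on UNIV f \<and> uniformly_continuous_on UNIV (inv f)}"

text \<open>The iterate \<open>f\<^sup>n\<close> for integer \<open>n\<close>; meaningful only for bijective \<open>f\<close>.\<close>

definition ziter :: "('a \<Rightarrow> 'a) \<Rightarrow> int \<Rightarrow> 'a \<Rightarrow> 'a" where
  "ziter f n = (if 0 \<le> n then f ^^ nat n else inv f ^^ nat (- n))"

definition mandelkern_locally_compact :: "'a::metric_space set \<Rightarrow> bool" where
  "mandelkern_locally_compact X \<longleftrightarrow>
     (\<forall>B\<subseteq>X. bounded B \<longrightarrow> (\<exists>K\<subseteq>X. compact K \<and> B \<subseteq> K))"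

text \<open>The truncation at 1 keeps the supremum over a set of reals bounded.\<close>

definition map_dist :: "('a::metric_space \<Rightarrow> 'a) \<Rightarrow> ('a \<Rightarrow> 'a) \<Rightarrow> real" where
  "map_dist f g = (SUP x. min (dist (f x) (g x)) 1)"

text \<open>Sequences are indexed by the positive integers; the value at index 0 is irrelevant.\<close>

definition orbitally_convergent ::
    "(nat \<Rightarrow> 'a::metric_space \<Rightarrow> 'a) \<Rightarrow> ('a \<Rightarrow> 'a) \<Rightarrow> bool" where
  "orbitally_convergent G g \<longleftrightarrow>
     (\<forall>n\<ge>1. uniformly_continuous_on UNIV (G n)) \<and> uniformly_continuous_on UNIV g \<and>
     (\<forall>\<epsilon>>0. \<exists>N\<ge>1. \<forall>n\<ge>N. \<forall>x. \<forall>k\<ge>1. dist ((G n ^^ k) x) ((g ^^ k) x) < \<epsilon>)"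

definition expansive :: "('a::metric_space \<Rightarrow> 'a) \<Rightarrow> bool" where
  "expansive f \<longleftrightarrow>
     (\<exists>\<delta>>0. \<forall>x y. x \<noteq> y \<longrightarrow> (\<exists>n::int. dist (ziter f n x) (ziter f n y) > \<delta>))"

definition zorbit :: "('a \<Rightarrow> 'a) \<Rightarrow> 'a \<Rightarrow> 'a set" where
  "zorbit g x = {ziter g n x | n. True}"

definition pseudo_orbit ::
    "('a::metric_space \<Rightarrow> 'a) \<Rightarrow> 'a \<Rightarrow> real \<Rightarrow> (int \<Rightarrow> 'a) \<Rightarrow> bool" where
  "pseudo_orbit f x \<delta> p \<longleftrightarrow> p 0 = x \<and> (\<forall>i. dist (f (p i)) (p (i + 1)) < \<delta>)"

definition traced_by ::
    "('a::metric_space \<Rightarrow> 'a) \<Rightarrow> real \<Rightarrow> (int \<Rightarrow> 'a) \<Rightarrow> 'a \<Rightarrow> bool" where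
  "traced_by f \<epsilon> p y \<longleftrightarrow> (\<forall>i. dist (ziter f i y) (p i) < \<epsilon>)"

text \<open>The suffix \<open>_mod\<close> marks the sets \<open>Sh(f,x,\<epsilon>)\<close>, \<open>P\<^sub>\<alpha>(f,x,\<epsilon>)\<close> and \<open>Wts(f,x,\<epsilon>)\<close> of
  admissible moduli \<open>\<delta>\<close>; without it the names denote sets of points.\<close>

definition Sh_mod :: "('a::metric_space \<Rightarrow> 'a) \<Rightarrow> 'a \<Rightarrow> real \<Rightarrow> real set" where
  "Sh_mod f x \<epsilon> = {\<delta>. \<delta> > 0 \<and> (\<forall>p. pseudo_orbit f x \<delta> p \<longrightarrow> (\<exists>y. traced_by f \<epsilon> p y))}"

definition Sh :: "('a::metric_space \<Rightarrow> 'a) \<Rightarrow> 'a set" where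
  "Sh f = {x. \<forall>\<epsilon>>0. \<exists>\<delta>. \<delta> \<in> Sh_mod f x \<epsilon>}"

definition P_alpha_mod :: "('a::metric_space \<Rightarrow> 'a) \<Rightarrow> 'a \<Rightarrow> real \<Rightarrow> real set" where
  "P_alpha_mod f x \<epsilon> = {\<delta>. \<delta> > 0 \<and>
     (\<forall>g\<in>UE. map_dist f g < \<delta> \<longrightarrow> (\<exists>y. \<forall>n. dist (ziter f n y) (ziter g n x) < \<epsilon>))}"

definition P_alpha :: "('a::metric_space \<Rightarrow> 'a) \<Rightarrow> 'a set" where
  "P_alpha f = {x. \<forall>\<epsilon>>0. \<exists>\<delta>. \<delta> \<in> P_alpha_mod f x \<epsilon>}"

definition Wts_mod :: "('a::metric_space \<Rightarrow> 'a) \<Rightarrow> 'a \<Rightarrow> real \<Rightarrow> real set" where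
  "Wts_mod f x \<epsilon> = {\<delta>. \<delta> > 0 \<and>
     (\<forall>g\<in>UE. map_dist f g < \<delta> \<longrightarrow>
        (\<exists>h. continuous_on (closure (zorbit g x)) h \<and>
             (\<forall>n. \<forall>y\<in>closure (zorbit g x). dist (ziter f n (h y)) (ziter g n y) < \<epsilon>) \<and>
             (\<forall>y\<in>closure (zorbit g x). dist (h y) y < \<epsilon>)))}"

definition Wts :: "('a::metric_space \<Rightarrow> 'a) \<Rightarrow> 'a set" where
  "Wts f = {x. \<forall>\<epsilon>>0. \<exists>\<delta>. \<delta> \<in> Wts_mod f x \<epsilon>}"

definition Ts :: "('a::metric_space \<Rightarrow> 'a) \<Rightarrow> 'a set" where
  "Ts f = {x. \<forall>\<epsilon>>0. \<exists>\<delta>>0. \<forall>g\<in>UE. map_dist f g < \<delta> \<longrightarrow>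
     (\<exists>h. continuous_on (closure (zorbit g x)) h \<and>
          (\<forall>y\<in>closure (zorbit g x). f (h y) = h (g y)) \<and>
          (\<forall>y\<in>closure (zorbit g x). dist (h y) y < \<epsilon>))}"

end

(* Orbital convergence of both f_n and inv f_n says that all integer iterates of f_n converge to those
   of f uniformly in the point and in the exponent. Hence a modulus for f (or for f_n) at scale
   \<epsilon>/2, once halved, is a modulus at scale \<epsilon> for every map with sufficiently close iterates, and the
   relation of closeness is symmetric; this gives (i)-(iii). For (iv), a semiconjugacy h close to the
   identity shadows all orbits since f^n o h = h o g^n; conversely, if h shadows, then h (g y) and
   f (h y) have f-orbits that stay uniformly close, so expansivity identifies them. *)

theory Submission
  imports Defs
begin

section \<open>Integer iterates\<close>

lemma ziter_0 [simp]: "ziter f 0 = id"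
  by (auto simp: ziter_def)

lemma ziter_1 [simp]: "ziter f 1 = f"
  by (auto simp: ziter_def)

text \<open>The extra \<open>f\<close> is put innermost, so that the orbit of \<open>f y\<close>
  reads as the shifted orbit of \<open>y\<close>. For negative \<open>n\<close> it cancels one
  factor \<open>inv f\<close>.\<close>

lemma ziter_add_1:
  assumes "bij f"
  shows "ziter f (n + 1) = ziter f n \<circ> f"
proof (cases "0 \<le> n")
  case True
  then show ?thesis
    by (simp add: ziter_def nat_add_distrib funpow_Suc_right del: funpow.simps)
next
  case False
  then obtain k where n: "n = - int (Suc k)"
    by (metis int_cases not_le of_nat_0_le_iff)
  have inv: "inv f \<circ> f = id"
    using assms by (simp add: bij_is_inj)
  have "ziter f n = inv f ^^ k \<circ> inv f"
    using n by (simp add: ziter_def funpow_Suc_right nat_add_distrib del: funpow.simps)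
  \<comment> \<open>For \<open>k = 0\<close> the exponent \<open>n + 1\<close> is 0 and falls into
    the nonnegative branch of \<open>ziter\<close>, whence the case split.\<close>
  moreover have "ziter f (n + 1) = inv f ^^ k"
    using n by (cases "k = 0") (auto simp: ziter_def)
  ultimately show ?thesis
    by (simp add: comp_assoc inv)
qed

section \<open>Uniform closeness of orbits and the distance of maps\<close>

definition orbitally_close :: "real \<Rightarrow> ('a::metric_space \<Rightarrow> 'a) \<Rightarrow> ('a \<Rightarrow> 'a) \<Rightarrow> bool" where
  "orbitally_close \<eta> f g \<longleftrightarrow> (\<forall>n x. dist (ziter f n x) (ziter g n x) < \<eta>)"

lemma orbitally_close_commute: "orbitally_close \<eta> f g \<longleftrightarrow> orbitally_close \<eta> g f"
  by (simp add: orbitally_close_def dist_commute)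

lemma orbitally_close_mono: "orbitally_close \<eta> f g \<Longrightarrow> \<eta> \<le> \<theta> \<Longrightarrow> orbitally_close \<theta> f g"
  by (auto simp: orbitally_close_def intro: less_le_trans)

lemma orbitally_close_dist: "orbitally_close \<eta> f g \<Longrightarrow> dist (f x) (g x) < \<eta>"
  by (metis orbitally_close_def ziter_1)

text \<open>Positive exponents are controlled by the first convergence, negative ones by the
  convergence of the inverses; at exponent 0 both iterates are the identity.\<close>

lemma orbitally_convergent_imp_eventually_close:
  assumes "orbitally_convergent F f" "orbitally_convergent (\<lambda>n. inv (F n)) (inv f)" "\<eta> > 0"
  shows "\<exists>N\<ge>1. \<forall>n\<ge>N. orbitally_close \<eta> (F n) f"
proof -
  obtain N where N: "N \<ge> 1" "\<And>n x k. n \<ge> N \<Longrightarrow> k \<ge> 1 \<Longrightarrow> dist ((F n ^^ k) x) ((f ^^ k) x) < \<eta>"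
    using assms(1,3) unfolding orbitally_convergent_def by metis
  obtain N' where N':
    "\<And>n x k. n \<ge> N' \<Longrightarrow> k \<ge> 1 \<Longrightarrow> dist ((inv (F n) ^^ k) x) ((inv f ^^ k) x) < \<eta>"
    using assms(2,3) unfolding orbitally_convergent_def by metis
  have "dist (ziter (F n) k x) (ziter f k x) < \<eta>" if "n \<ge> max N N'" for n k x
  proof (cases k "0::int" rule: linorder_cases)
    case less
    then have "nat (- k) \<ge> 1" by simp
    then show ?thesis using less N'[of n "nat (- k)" x] that by (simp add: ziter_def)
  next
    case equal
    then show ?thesis using assms(3) by simp
  next
    case greater
    then have "nat k \<ge> 1" by simp
    then show ?thesis using greater N(2)[of n "nat k" x] that by (simp add: ziter_def)
  qed
  then show ?thesis
    using N(1) by (metis le_max_iff_disj orbitally_close_def)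
qed

lemma map_dist_upper: "min (dist (f x) (g x)) 1 \<le> map_dist f g"
  unfolding map_dist_def by (rule cSUP_upper) (auto intro: bdd_aboveI[where M = 1])

text \<open>A strict pointwise bound survives the supremum only as a weak one; the strict inequality
  comes from the first assumption.\<close>

lemma map_dist_triangle_less:
  assumes "map_dist f g < \<delta> / 2" "\<And>x. dist (f x) (f' x) < \<delta> / 2"
  shows "map_dist f' g < \<delta>"
proof -
  have "map_dist f' g \<le> map_dist f g + \<delta> / 2"
    unfolding map_dist_def[of f']
  proof (rule cSUP_least)
    fix x
    have "dist (f' x) (g x) \<le> dist (f x) (g x) + dist (f x) (f' x)"
      by (metis add.commute dist_commute dist_triangle)
    moreover have "0 \<le> dist (f x) (f' x)"
      by simp
    \<comment> \<open>Truncation respects the triangle inequality: min (a + b) 1 \<le> min a 1 + b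
      for b \<ge> 0.\<close>
    ultimately have "min (dist (f' x) (g x)) 1 \<le> min (dist (f x) (g x)) 1 + dist (f x) (f' x)"
      by linarith
    then show "min (dist (f' x) (g x)) 1 \<le> map_dist f g + \<delta> / 2"
      using map_dist_upper[of f x g] assms(2)[of x] by linarith
  qed simp
  then show ?thesis
    using assms(1) by linarith
qed

section \<open>Transfer of moduli between orbitally close maps\<close>

lemma orbitally_close_ziter_dist:
  assumes "orbitally_close \<eta> f f'" "dist (ziter f n y) z < \<epsilon>"
  shows "dist (ziter f' n y) z < \<eta> + \<epsilon>"
proof -
  have "dist (ziter f n y) (ziter f' n y) < \<eta>"
    using assms(1) by (simp add: orbitally_close_def)
  then show ?thesis
    using assms(2) dist_triangle3[of "ziter f' n y" z "ziter f n y"] by linarith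
qed

text \<open>Halving \<delta> pays for reading a pseudo orbit of \<open>f'\<close> as one of
  \<open>f\<close>; halving \<epsilon> pays for letting the tracing point found for \<open>f\<close>
  trace through \<open>f'\<close>.\<close>

lemma Sh_mod_transfer:
  assumes "\<delta> \<in> Sh_mod f x (\<epsilon> / 2)" "orbitally_close (\<delta> / 2) f f'" "orbitally_close (\<epsilon> / 2) f f'"
  shows "\<delta> / 2 \<in> Sh_mod f' x \<epsilon>"
proof -
  have "\<exists>y. traced_by f' \<epsilon> p y" if p: "pseudo_orbit f' x (\<delta> / 2) p" for p
  proof -
    have "dist (f (p i)) (p (i + 1)) < \<delta>" for i
    proof -
      have "dist (f' (p i)) (p (i + 1)) < \<delta> / 2"
        using p by (simp add: pseudo_orbit_def)
      then show ?thesis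
        using orbitally_close_dist[OF assms(2), of "p i"]
          dist_triangle[of "f (p i)" "p (i + 1)" "f' (p i)"] by linarith
    qed
    then obtain y where "traced_by f (\<epsilon> / 2) p y"
      using p assms(1) by (auto simp: pseudo_orbit_def Sh_mod_def)
    then have "traced_by f' \<epsilon> p y"
      using orbitally_close_ziter_dist[OF assms(3)] unfolding traced_by_def by fastforce
    then show ?thesis ..
  qed
  then show ?thesis
    using assms(1) by (simp add: Sh_mod_def)
qed

text \<open>A perturbation \<open>g\<close> of \<open>f'\<close> is also one of \<open>f\<close>,
  and the point \<open>y\<close> obtained for \<open>f\<close> serves for \<open>f'\<close> as
  well.\<close>

lemma P_alpha_mod_transfer:
  assumes "\<delta> \<in> P_alpha_mod f x (\<epsilon> / 2)"
    and "orbitally_close (\<delta> / 2) f f'" "orbitally_close (\<epsilon> / 2) f f'"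
  shows "\<delta> / 2 \<in> P_alpha_mod f' x \<epsilon>"
proof -
  have "\<exists>y. \<forall>n. dist (ziter f' n y) (ziter g n x) < \<epsilon>"
    if g: "g \<in> UE" "map_dist f' g < \<delta> / 2" for g
  proof -
    have "map_dist f g < \<delta>"
      using map_dist_triangle_less[OF g(2)] orbitally_close_dist[OF assms(2)]
      by (simp add: dist_commute)
    then obtain y where y: "\<And>n. dist (ziter f n y) (ziter g n x) < \<epsilon> / 2"
      using g(1) assms(1) by (auto simp: P_alpha_mod_def)
    have "dist (ziter f' n y) (ziter g n x) < \<epsilon>" for n
      using orbitally_close_ziter_dist[OF assms(3) y] by simp
    then show ?thesis by blast
  qed
  then show ?thesis
    using assms(1) by (simp add: P_alpha_mod_def)
qed

text \<open>The domain of \<open>h\<close> depends only on \<open>g\<close> and \<open>x\<close>, so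
  the map obtained for \<open>f\<close> can be kept unchanged for \<open>f'\<close>.\<close>

lemma Wts_mod_transfer:
  assumes "\<delta> \<in> Wts_mod f x (\<epsilon> / 2)"
    and "orbitally_close (\<delta> / 2) f f'" "orbitally_close (\<epsilon> / 2) f f'"
  shows "\<delta> / 2 \<in> Wts_mod f' x \<epsilon>"
proof -
  have "\<exists>h. continuous_on (closure (zorbit g x)) h \<and>
          (\<forall>n. \<forall>y\<in>closure (zorbit g x). dist (ziter f' n (h y)) (ziter g n y) < \<epsilon>) \<and>
          (\<forall>y\<in>closure (zorbit g x). dist (h y) y < \<epsilon>)"
    if g: "g \<in> UE" "map_dist f' g < \<delta> / 2" for g
  proof -
    have "map_dist f g < \<delta>"
      using map_dist_triangle_less[OF g(2)] orbitally_close_dist[OF assms(2)]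
      by (simp add: dist_commute)
    then obtain h where h: "continuous_on (closure (zorbit g x)) h"
      "\<And>n y. y \<in> closure (zorbit g x) \<Longrightarrow> dist (ziter f n (h y)) (ziter g n y) < \<epsilon> / 2"
      using g(1) assms(1) by (auto simp: Wts_mod_def)
    have *: "dist (ziter f' n (h y)) (ziter g n y) < \<epsilon>" if "y \<in> closure (zorbit g x)" for n y
      using orbitally_close_ziter_dist[OF assms(3) h(2)[OF that]] by simp
    \<comment> \<open>Closeness of \<open>h\<close> to the identity is the exponent 0 case of the
      shadowing estimate.\<close>
    then have "dist (h y) y < \<epsilon>" if "y \<in> closure (zorbit g x)" for y
      using *[OF that, of 0] by simp
    with * h(1) show ?thesis by blast
  qed
  then show ?thesis
    using assms(1) by (simp add: Wts_mod_def)
qed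

text \<open>Isolates what the three notions share. As \<open>transfer\<close> holds for arbitrary
  pairs of close maps, it carries a modulus from \<open>f\<close> to all late \<open>F n\<close> in
  one direction and from a single \<open>F n\<close> back to \<open>f\<close> in the other.\<close>

lemma ex_modulus_iff_eventually_common_modulus:
  fixes M :: "('a::metric_space \<Rightarrow> 'a) \<Rightarrow> real \<Rightarrow> real set"
  assumes conv: "orbitally_convergent F f" "orbitally_convergent (\<lambda>n. inv (F n)) (inv f)"
    and pos: "\<And>g \<epsilon> \<delta>. \<delta> \<in> M g \<epsilon> \<Longrightarrow> \<delta> > 0"
    and transfer: "\<And>g g' \<epsilon> \<delta>. \<lbrakk>\<delta> \<in> M g (\<epsilon> / 2); orbitally_close (\<delta> / 2) g g';
      orbitally_close (\<epsilon> / 2) g g'\<rbrakk> \<Longrightarrow> \<delta> / 2 \<in> M g' \<epsilon>"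
  shows "(\<forall>\<epsilon>>0. \<exists>\<delta>. \<delta> \<in> M f \<epsilon>) \<longleftrightarrow> (\<forall>\<epsilon>>0. (\<Union>m\<in>{1..}. \<Inter>n\<in>{m..}. M (F n) \<epsilon>) \<noteq> {})"
proof (intro iffI allI impI)
  fix \<epsilon> :: real assume "\<epsilon> > 0" and "\<forall>\<epsilon>>0. \<exists>\<delta>. \<delta> \<in> M f \<epsilon>"
  then obtain \<delta> where \<delta>: "\<delta> \<in> M f (\<epsilon> / 2)"
    by (meson half_gt_zero)
  then have "min (\<delta> / 2) (\<epsilon> / 2) > 0"
    using pos \<open>\<epsilon> > 0\<close> by simp
  then obtain N where N: "N \<ge> 1" "\<And>n. n \<ge> N \<Longrightarrow> orbitally_close (min (\<delta> / 2) (\<epsilon> / 2)) (F n) f"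
    using orbitally_convergent_imp_eventually_close[OF conv] by blast
  have "\<delta> / 2 \<in> M (F n) \<epsilon>" if "n \<ge> N" for n
  proof -
    \<comment> \<open>The minimum meets both closeness demands of \<open>transfer\<close> at
      once.\<close>
    have "orbitally_close (min (\<delta> / 2) (\<epsilon> / 2)) f (F n)"
      using N(2)[OF that] by (rule orbitally_close_commute[THEN iffD1])
    then show ?thesis
      using \<delta> by (intro transfer[of \<delta> f]) (auto elim: orbitally_close_mono)
  qed
  then show "(\<Union>m\<in>{1..}. \<Inter>n\<in>{m..}. M (F n) \<epsilon>) \<noteq> {}"
    using N(1) by blast
next
  fix \<epsilon> :: real assume "\<epsilon> > 0" and "\<forall>\<epsilon>>0. (\<Union>m\<in>{1..}. \<Inter>n\<in>{m..}. M (F n) \<epsilon>) \<noteq> {}"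
  then have "(\<Union>m\<in>{1..}. \<Inter>n\<in>{m..}. M (F n) (\<epsilon> / 2)) \<noteq> {}"
    by simp
  then obtain m \<delta> where \<delta>: "\<And>n. n \<ge> m \<Longrightarrow> \<delta> \<in> M (F n) (\<epsilon> / 2)"
    by auto
  then have "min (\<delta> / 2) (\<epsilon> / 2) > 0"
    using pos[OF \<delta>[of m]] \<open>\<epsilon> > 0\<close> by simp
  then obtain N where N: "\<And>n. n \<ge> N \<Longrightarrow> orbitally_close (min (\<delta> / 2) (\<epsilon> / 2)) (F n) f"
    using orbitally_convergent_imp_eventually_close[OF conv] by blast
  \<comment> \<open>One index suffices: past \<open>m\<close> the common \<delta> is a modulus, past
    \<open>N\<close> the map is close to \<open>f\<close>.\<close>
  let ?n = "max m N"
  have "\<delta> \<in> M (F ?n) (\<epsilon> / 2)" "orbitally_close (min (\<delta> / 2) (\<epsilon> / 2)) (F ?n) f"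
    by (simp_all add: \<delta> N)
  then have "\<delta> / 2 \<in> M f \<epsilon>"
    by (intro transfer[of \<delta> "F ?n"]) (auto elim: orbitally_close_mono)
  then show "\<exists>\<delta>. \<delta> \<in> M f \<epsilon>" ..
qed

section \<open>Invariant orbit closures, semiconjugacies and topological stability\<close>

lemma UE_D:
  assumes "f \<in> UE"
  shows UE_bij: "bij f"
    and UE_continuous: "continuous_on UNIV f"
    and UE_continuous_inv: "continuous_on UNIV (inv f)"
  using assms by (auto simp: UE_def uniformly_continuous_imp_continuous)

lemma image_zorbit:
  assumes "bij f"
  shows "f ` zorbit f x \<subseteq> zorbit f x" "inv f ` zorbit f x \<subseteq> zorbit f x"
proof -
  have step: "f (ziter f n x) = ziter f (n + 1) x" for n
  proof (cases "0 \<le> n")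
    case True
    then show ?thesis
      by (simp add: ziter_def nat_add_distrib)
  next
    case False
    then obtain k where n: "n = - int (Suc k)"
      by (metis int_cases not_le of_nat_0_le_iff)
    \<comment> \<open>Here the outermost \<open>inv f\<close> is peeled off, and applying
      \<open>f\<close> removes it.\<close>
    then have "ziter f n x = inv f (ziter f (n + 1) x)"
      by (cases k) (auto simp: ziter_def nat_add_distrib)
    then show ?thesis
      using assms by (simp add: bij_is_surj surj_f_inv_f)
  qed
  show "f ` zorbit f x \<subseteq> zorbit f x"
    by (auto simp: zorbit_def step)
  have "inv f (ziter f n x) = ziter f (n - 1) x" for n
    using step[of "n - 1"] assms by (metis bij_inv_eq_iff diff_add_cancel)
  then show "inv f ` zorbit f x \<subseteq> zorbit f x"
    by (auto simp: zorbit_def)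
qed

text \<open>Continuity of \<open>f\<close> and \<open>inv f\<close> extends the invariance of the
  orbit to its closure.\<close>

lemma closure_zorbit_invariant:
  assumes "f \<in> UE" "y \<in> closure (zorbit f x)"
  shows "f y \<in> closure (zorbit f x)" "inv f y \<in> closure (zorbit f x)"
proof -
  have "g y \<in> closure (zorbit f x)"
    if "continuous_on UNIV g" "g ` zorbit f x \<subseteq> zorbit f x" for g
  proof -
    have "g ` closure (zorbit f x) \<subseteq> closure (zorbit f x)"
      using that closure_subset[of "zorbit f x"]
      by (intro image_closure_subset) (auto intro: continuous_on_subset)
    then show ?thesis using assms(2) by blast
  qed
  then show "f y \<in> closure (zorbit f x)" "inv f y \<in> closure (zorbit f x)"
    using UE_D[OF assms(1)] image_zorbit[OF UE_bij[OF assms(1)]] by simp_all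
qed

lemma funpow_semiconj:
  assumes "\<And>y. y \<in> S \<Longrightarrow> g y \<in> S" "\<And>y. y \<in> S \<Longrightarrow> f (h y) = h (g y)" "y \<in> S"
  shows "(g ^^ n) y \<in> S \<and> (f ^^ n) (h y) = h ((g ^^ n) y)"
  using assms by (induction n) auto

text \<open>Evaluating the semiconjugacy at \<open>inv g y\<close>, which stays in \<open>S\<close>,
  shows that \<open>h\<close> also intertwines the inverses. Negative exponents are then positive
  iterates of those.\<close>

lemma ziter_semiconj:
  assumes "bij f" "bij g"
    and inv: "\<And>y. y \<in> S \<Longrightarrow> g y \<in> S" "\<And>y. y \<in> S \<Longrightarrow> inv g y \<in> S"
    and semiconj: "\<And>y. y \<in> S \<Longrightarrow> f (h y) = h (g y)" and "y \<in> S"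
  shows "ziter g n y \<in> S" "ziter f n (h y) = h (ziter g n y)"
proof -
  have "inv f (h y) = h (inv g y)" if "y \<in> S" for y
  proof -
    have "f (h (inv g y)) = h y"
      using semiconj[OF inv(2)[OF that]] assms(2) by (simp add: bij_is_surj surj_f_inv_f)
    then show ?thesis
      using assms(1) by (metis bij_inv_eq_iff)
  qed
  note neg = funpow_semiconj[of S "inv g" "inv f" h, OF inv(2) this \<open>y \<in> S\<close>]
  note pos = funpow_semiconj[of S g f h, OF inv(1) semiconj \<open>y \<in> S\<close>]
  show "ziter g n y \<in> S" "ziter f n (h y) = h (ziter g n y)"
    using pos neg by (auto simp: ziter_def)
qed

text \<open>The same \<delta> and \<open>h\<close> work: the semiconjugacy turns the shadowing
  distance at exponent \<open>n\<close> into the distance from \<open>h\<close> to the identity at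
  \<open>ziter g n y\<close>, a point of the invariant closure.\<close>

lemma Ts_subset_Wts:
  assumes "f \<in> UE"
  shows "Ts f \<subseteq> Wts f"
proof
  fix x assume x: "x \<in> Ts f"
  show "x \<in> Wts f"
    unfolding Wts_def
  proof (intro CollectI allI impI)
    fix \<epsilon> :: real assume "\<epsilon> > 0"
    then obtain \<delta> where \<delta>: "\<delta> > 0"
      and h: "\<forall>g\<in>UE. map_dist f g < \<delta> \<longrightarrow>
        (\<exists>h. continuous_on (closure (zorbit g x)) h \<and>
          (\<forall>y\<in>closure (zorbit g x). f (h y) = h (g y)) \<and>
          (\<forall>y\<in>closure (zorbit g x). dist (h y) y < \<epsilon>))"
      using x unfolding Ts_def by auto
    have "\<exists>h. continuous_on (closure (zorbit g x)) h \<and>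
          (\<forall>n. \<forall>y\<in>closure (zorbit g x). dist (ziter f n (h y)) (ziter g n y) < \<epsilon>) \<and>
          (\<forall>y\<in>closure (zorbit g x). dist (h y) y < \<epsilon>)"
      if g: "g \<in> UE" "map_dist f g < \<delta>" for g
    proof -
      let ?S = "closure (zorbit g x)"
      obtain h where h: "continuous_on ?S h" "\<And>y. y \<in> ?S \<Longrightarrow> f (h y) = h (g y)"
        "\<And>y. y \<in> ?S \<Longrightarrow> dist (h y) y < \<epsilon>"
        using h g by blast
      have "dist (ziter f n (h y)) (ziter g n y) < \<epsilon>" if "y \<in> ?S" for n y
        using ziter_semiconj[of f g ?S h y n] h(2,3) that closure_zorbit_invariant[OF g(1)]
          UE_bij[OF assms] UE_bij[OF g(1)] by metis
      with h show ?thesis by blast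
    qed
    with \<delta> show "\<exists>\<delta>. \<delta> \<in> Wts_mod f x \<epsilon>"
      unfolding Wts_mod_def by blast
  qed
qed

lemma expansive_Wts_subset_Ts:
  assumes "f \<in> UE" "expansive f"
  shows "Wts f \<subseteq> Ts f"
proof
  fix x assume x: "x \<in> Wts f"
  obtain e where e: "e > 0" "\<forall>y z. y \<noteq> z \<longrightarrow> (\<exists>n. dist (ziter f n y) (ziter f n z) > e)"
    using assms(2) unfolding expansive_def by blast
  show "x \<in> Ts f"
    unfolding Ts_def
  proof (intro CollectI allI impI)
    fix \<epsilon> :: real assume "\<epsilon> > 0"
    \<comment> \<open>Two errors below e / 2 add up to less than the expansivity constant
      \<open>e\<close>; the bound \<epsilon> keeps \<open>h\<close> close enough to the
      identity.\<close>
    define \<eta> where "\<eta> = min \<epsilon> (e / 2)"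
    have "\<eta> > 0" using \<open>\<epsilon> > 0\<close> e(1) by (simp add: \<eta>_def)
    then obtain \<delta> where \<delta>: "\<delta> \<in> Wts_mod f x \<eta>"
      using x unfolding Wts_def by auto
    have "\<exists>h. continuous_on (closure (zorbit g x)) h \<and>
          (\<forall>y\<in>closure (zorbit g x). f (h y) = h (g y)) \<and>
          (\<forall>y\<in>closure (zorbit g x). dist (h y) y < \<epsilon>)"
      if g: "g \<in> UE" "map_dist f g < \<delta>" for g
    proof -
      let ?S = "closure (zorbit g x)"
      obtain h where h: "continuous_on ?S h"
        "\<And>n y. y \<in> ?S \<Longrightarrow> dist (ziter f n (h y)) (ziter g n y) < \<eta>"
        "\<And>y. y \<in> ?S \<Longrightarrow> dist (h y) y < \<eta>"
        using \<delta> g unfolding Wts_mod_def by blast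
      have "f (h y) = h (g y)" if y: "y \<in> ?S" for y
      proof -
        have "dist (ziter f n (f (h y))) (ziter f n (h (g y))) \<le> e" for n
        proof -
          \<comment> \<open>This is the shadowing of \<open>y\<close> shifted by one. The next
            estimate shadows \<open>g y\<close> directly, so both \<open>f\<close>-orbits follow the
            \<open>g\<close>-orbit of \<open>g y\<close>.\<close>
          have "dist (ziter f n (f (h y))) (ziter g n (g y)) < \<eta>"
            using h(2)[OF y, of "n + 1"] UE_bij[OF assms(1)] UE_bij[OF g(1)]
            by (simp add: ziter_add_1)
          moreover have "dist (ziter f n (h (g y))) (ziter g n (g y)) < \<eta>"
            by (intro h(2) closure_zorbit_invariant(1) g(1) y)
          ultimately have "dist (ziter f n (f (h y))) (ziter f n (h (g y))) < \<eta> + \<eta>"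
            using dist_triangle2[of "ziter f n (f (h y))" "ziter f n (h (g y))" "ziter g n (g y)"]
            by linarith
          then show ?thesis
            by (simp add: \<eta>_def)
        qed
        then show ?thesis
          using e(2) by (meson not_le)
      qed
      with h show ?thesis
        by (auto simp: \<eta>_def)
    qed
    moreover have "\<delta> > 0"
      using \<delta> by (simp add: Wts_mod_def)
    ultimately show "\<exists>\<delta>>0. \<forall>g\<in>UE. map_dist f g < \<delta> \<longrightarrow>
       (\<exists>h. continuous_on (closure (zorbit g x)) h \<and>
          (\<forall>y\<in>closure (zorbit g x). f (h y) = h (g y)) \<and>
          (\<forall>y\<in>closure (zorbit g x). dist (h y) y < \<epsilon>))"
      by blast
  qed
qed

theorem theorem3p8:
  fixes f :: "'a::metric_space \<Rightarrow> 'a"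
    and F :: "nat \<Rightarrow> 'a \<Rightarrow> 'a"
    and x :: 'a
  assumes "f \<in> UE"
    and "\<And>n. n \<ge> 1 \<Longrightarrow> F n \<in> UE"
    and "orbitally_convergent F f"
    and "orbitally_convergent (\<lambda>n. inv (F n)) (inv f)"
  shows "(x \<in> Sh f \<longleftrightarrow>
           (\<forall>\<epsilon>>0. (\<Union>m\<in>{1..}. \<Inter>n\<in>{m..}. Sh_mod (F n) x \<epsilon>) \<noteq> {})) \<and>
         (x \<in> P_alpha f \<longleftrightarrow>
           (\<forall>\<epsilon>>0. (\<Union>m\<in>{1..}. \<Inter>n\<in>{m..}. P_alpha_mod (F n) x \<epsilon>) \<noteq> {})) \<and>
         (x \<in> Wts f \<longleftrightarrow>
           (\<forall>\<epsilon>>0. (\<Union>m\<in>{1..}. \<Inter>n\<in>{m..}. Wts_mod (F n) x \<epsilon>) \<noteq> {})) \<and>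
         (expansive f \<and> mandelkern_locally_compact (UNIV :: 'a set) \<longrightarrow>
           (x \<in> Ts f \<longleftrightarrow>
             (\<forall>\<epsilon>>0. (\<Union>m\<in>{1..}. \<Inter>n\<in>{m..}. Wts_mod (F n) x \<epsilon>) \<noteq> {})))"
proof -
  \<comment> \<open>For each notion the criterion leaves two obligations: moduli are positive, and
    they transfer between close maps.\<close>
  note conv = ex_modulus_iff_eventually_common_modulus[OF assms(3,4)]
  have "x \<in> Sh f \<longleftrightarrow> (\<forall>\<epsilon>>0. (\<Union>m\<in>{1..}. \<Inter>n\<in>{m..}. Sh_mod (F n) x \<epsilon>) \<noteq> {})"
    unfolding Sh_def mem_Collect_eq
    by (rule conv[where M = "\<lambda>g. Sh_mod g x"]) (simp add: Sh_mod_def, rule Sh_mod_transfer)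
  moreover have "x \<in> P_alpha f \<longleftrightarrow>
      (\<forall>\<epsilon>>0. (\<Union>m\<in>{1..}. \<Inter>n\<in>{m..}. P_alpha_mod (F n) x \<epsilon>) \<noteq> {})"
    unfolding P_alpha_def mem_Collect_eq
    by (rule conv[where M = "\<lambda>g. P_alpha_mod g x"]) (simp add: P_alpha_mod_def, rule P_alpha_mod_transfer)
  moreover have "x \<in> Wts f \<longleftrightarrow> (\<forall>\<epsilon>>0. (\<Union>m\<in>{1..}. \<Inter>n\<in>{m..}. Wts_mod (F n) x \<epsilon>) \<noteq> {})"
    unfolding Wts_def mem_Collect_eq
    by (rule conv[where M = "\<lambda>g. Wts_mod g x"]) (simp add: Wts_mod_def, rule Wts_mod_transfer)
  \<comment> \<open>Through this equality the last equivalence becomes the one for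
    \<open>Wts\<close>.\<close>
  moreover have "Ts f = Wts f" if "expansive f"
    using Ts_subset_Wts expansive_Wts_subset_Ts assms(1) that by blast
  ultimately show ?thesis
    by blast
qed

end
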